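(* Let $R$ be a non-commutative finite ring. Then $|\operatorname{Cent}(R)| = 4$ if and only if the additive quotient group $R/Z(R)$ is isomorphic, as a group, to $\mathbb{Z}_2 \times \mathbb{Z}_2$.
   Context: Rings are associative and not assumed to have a unity. For $r \in R$, the centralizer of $r$ is the subring $C(r) = \{s \in R : rs = sr\}$, and $\operatorname{Cent}(R) = \{C(r) : r \in R\}$ is the set of all distinct centralizers. $Z(R) = \{s \in R : rs = sr \text{ for all } r \in R\}$ is the center. $R/Z(R)$ denotes the quotient of additive groups, and $\cong$ is isomorphism of additive groups. *)

theory Defs
  imports "HOL-Algebra.Algebra"
begin

text \<open>
  The library locale \<open>ring\<close> demands a unity. Here the multiplication is only associative and
  distributive; the field \<open>one\<close> of the record is left unconstrained and must never be used.
\<close>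

locale nonunital_ring = abelian_group R for R (structure) +
  assumes mult_closed: "\<lbrakk>x \<in> carrier R; y \<in> carrier R\<rbrakk> \<Longrightarrow> x \<otimes> y \<in> carrier R"
    and mult_assoc: "\<lbrakk>x \<in> carrier R; y \<in> carrier R; z \<in> carrier R\<rbrakk>
          \<Longrightarrow> (x \<otimes> y) \<otimes> z = x \<otimes> (y \<otimes> z)"
    and mult_l_distr: "\<lbrakk>x \<in> carrier R; y \<in> carrier R; z \<in> carrier R\<rbrakk>
          \<Longrightarrow> (x \<oplus> y) \<otimes> z = x \<otimes> z \<oplus> y \<otimes> z"
    and mult_r_distr: "\<lbrakk>x \<in> carrier R; y \<in> carrier R; z \<in> carrier R\<rbrakk>
          \<Longrightarrow> z \<otimes> (x \<oplus> y) = z \<otimes> x \<oplus> z \<otimes> y"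

definition commutative :: "('a, 'm) ring_scheme \<Rightarrow> bool" where
  "commutative R \<longleftrightarrow> (\<forall>x\<in>carrier R. \<forall>y\<in>carrier R. x \<otimes>\<^bsub>R\<^esub> y = y \<otimes>\<^bsub>R\<^esub> x)"

definition centralizer :: "('a, 'm) ring_scheme \<Rightarrow> 'a \<Rightarrow> 'a set" where
  "centralizer R r = {s \<in> carrier R. r \<otimes>\<^bsub>R\<^esub> s = s \<otimes>\<^bsub>R\<^esub> r}"

definition Cent :: "('a, 'm) ring_scheme \<Rightarrow> 'a set set" where
  "Cent R = centralizer R ` carrier R"

definition center :: "('a, 'm) ring_scheme \<Rightarrow> 'a set" where
  "center R = {s \<in> carrier R. \<forall>r\<in>carrier R. r \<otimes>\<^bsub>R\<^esub> s = s \<otimes>\<^bsub>R\<^esub> r}"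

lemma (in ring) is_nonunital_ring: "nonunital_ring R"
  by unfold_locales (auto simp: m_assoc l_distr r_distr)

end

theory Submission
  imports Defs
begin

text \<open>
  Multiplication matters only through a few facts about additive subgroups: each centralizer is
  one, every element lies in its own centralizer, and the centralizer of \<open>r\<close> is proper exactly
  when \<open>r\<close> is not central. So the proper centralizers, together with the center \<open>Z\<close>, cover
  \<open>R\<close>, and \<open>Z\<close> is the intersection of all centralizers.

  If there are four centralizers, \<open>R\<close> itself is one of them, and the other three are proper
  subgroups that cover \<open>R\<close>. By Scorza's theorem
  (\<open>quotient_by_cover_intersection_klein_four\<close>), a group covered by three proper subgroups has
  the Klein four-group as quotient by their intersection, which here is \<open>Z\<close>.

  Conversely, if \<open>Z\<close> has index four, there is little room for the centralizer of a noncentral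
  \<open>r\<close>: it lies strictly between \<open>Z\<close> and \<open>R\<close>, so by Lagrange's theorem it consists of just
  the two cosets \<open>Z\<close> and \<open>Z + r\<close> (\<open>intermediate_subgroup_of_index_four\<close>). The three
  nontrivial cosets therefore give three distinct proper centralizers, and \<open>R\<close> is the fourth.
\<close>

section \<open>Groups covered by three proper subgroups\<close>

text \<open>
  Two distinct involutions \<open>a\<close> and \<open>b\<close> generate a Klein four-group by \<open>(i, j) \<mapsto> a\<^sup>i b\<^sup>j\<close>. That
  they generate all of \<open>G\<close> is the assumption \<open>cover\<close>; that the four products differ follows.
\<close>
lemma (in comm_group) klein_four_groupI:
  assumes a: "a \<in> carrier G" "a \<noteq> \<one>" "a \<otimes> a = \<one>"
    and b: "b \<in> carrier G" "b \<noteq> \<one>" "b \<otimes> b = \<one>"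
    and ab: "a \<noteq> b"
    and cover: "carrier G \<subseteq> {\<one>, a, b, a \<otimes> b}"
  shows "G \<cong> integer_mod_group 2 \<times>\<times> integer_mod_group 2"
proof -
  let ?V = "integer_mod_group 2 \<times>\<times> integer_mod_group 2"
  define f where "f p = (if fst p = (0::int) then \<one> else a) \<otimes> (if snd p = (0::int) then \<one> else b)"
    for p
  have V: "carrier ?V = {(0,0), (0,1), (1,0), (1,1)}"
    by (auto simp: DirProd_def carrier_integer_mod_group)
  have "a \<otimes> b \<noteq> \<one>"
    using a b ab by (metis inv_equality)
  moreover have "a \<otimes> b \<noteq> a" "a \<otimes> b \<noteq> b"
    using a b by simp_all
  moreover have f: "f (0,0) = \<one>" "f (0,1) = b" "f (1,0) = a" "f (1,1) = a \<otimes> b"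
    using a b by (simp_all add: f_def)
  ultimately have "inj_on f (carrier ?V)"
    unfolding V using a b ab by (simp add: f)
  moreover have "f ` carrier ?V = carrier G"
    unfolding V using a b cover by (auto simp: f)
  moreover have "f \<in> hom ?V G"
  proof (rule homI)
    have cancel: "a \<otimes> (a \<otimes> z) = z" "b \<otimes> (b \<otimes> z) = z" if "z \<in> carrier G" for z
      using that a b by (simp_all flip: m_assoc)
    fix x y assume "x \<in> carrier ?V" "y \<in> carrier ?V"
    then show "f (x \<otimes>\<^bsub>?V\<^esub> y) = f x \<otimes> f y"
      unfolding V using a b by (elim insertE emptyE) (simp_all add: f m_ac cancel)
  qed (use a b in \<open>unfold V, elim insertE emptyE, simp_all add: f\<close>)
  ultimately have "f \<in> iso ?V G"
    by (simp add: iso_def bij_betw_def)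
  then have "?V \<cong> G"
    by (auto simp: is_iso_def)
  then show ?thesis
    by (simp add: DirProd_group group.iso_sym)
qed

lemma (in group) mult_mem_subgroup_iff_left:
  assumes "subgroup H G" "h \<in> H" "x \<in> carrier G"
  shows "h \<otimes> x \<in> H \<longleftrightarrow> x \<in> H"
  using assms
  by (metis inv_solve_left subgroup.m_closed subgroup.m_inv_closed subgroup.mem_carrier)

lemma (in group) mult_mem_subgroup_iff_right:
  assumes "subgroup H G" "h \<in> H" "x \<in> carrier G"
  shows "x \<otimes> h \<in> H \<longleftrightarrow> x \<in> H"
  using assms
  by (metis inv_solve_right subgroup.m_closed subgroup.m_inv_closed subgroup.mem_carrier)

lemma (in group) mult_of_private_elements:
  assumes A: "subgroup A G" and B: "subgroup B G"
    and u: "u \<in> A" "u \<notin> B" and v: "v \<in> B" "v \<notin> A"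
  shows "u \<otimes> v \<in> carrier G - (A \<union> B)"
  using mult_mem_subgroup_iff_left[OF A u(1)] mult_mem_subgroup_iff_right[OF B v(1)]
    subgroup.mem_carrier[OF A u(1)] subgroup.mem_carrier[OF B v(1)] u v by auto

text \<open>
  If neither of two proper subgroups contains the other, an element of \<open>A - B\<close> times one of
  \<open>B - A\<close> lies outside both. This is why a cover by three proper subgroups is irredundant: each of
  them has an element that is in neither of the other two.
\<close>
lemma (in group) two_proper_subgroups_not_cover:
  assumes A: "subgroup A G" "A \<noteq> carrier G" and B: "subgroup B G" "B \<noteq> carrier G"
  shows "\<exists>x\<in>carrier G. x \<notin> A \<and> x \<notin> B"
proof (rule ccontr)
  assume "\<not> ?thesis"
  then have cover: "x \<in> A \<or> x \<in> B" if "x \<in> carrier G" for x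
    using that by blast
  obtain a b where ab: "a \<in> carrier G" "a \<notin> B" "b \<in> carrier G" "b \<notin> A"
    using A(2) B(2) subgroup.subset[OF A(1)] subgroup.subset[OF B(1)] by blast
  then have "a \<in> A" "b \<in> B"
    using cover by auto
  then show False
    using cover ab mult_of_private_elements[OF A(1) B(1)] by blast
qed

text \<open>
  Pairwise intersections in the cover all coincide with the triple one. Take \<open>a\<close> only in \<open>A\<close> and
  \<open>b\<close> only in \<open>B\<close>. For \<open>x\<close> in both, multiplication by \<open>x\<close> does not move \<open>b\<close> into \<open>A\<close>, so
  \<open>a b\<close> and \<open>a b x\<close> both avoid \<open>A \<union> B\<close>. Both are then in \<open>C\<close>, and so is \<open>x\<close>.
\<close>
lemma (in group) pairwise_Int_subset_third_of_cover:
  assumes A: "subgroup A G" "A \<noteq> carrier G"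
    and B: "subgroup B G" "B \<noteq> carrier G"
    and C: "subgroup C G" "C \<noteq> carrier G"
    and cover: "carrier G = A \<union> B \<union> C"
  shows "A \<inter> B \<subseteq> C"
proof
  fix x assume x: "x \<in> A \<inter> B"
  obtain a where a: "a \<in> carrier G" "a \<notin> B" "a \<notin> C"
    using two_proper_subgroups_not_cover[OF B C] by blast
  obtain b where b: "b \<in> carrier G" "b \<notin> A" "b \<notin> C"
    using two_proper_subgroups_not_cover[OF A C] by blast
  have aA: "a \<in> A" and bB: "b \<in> B"
    using a b cover by auto
  have xG: "x \<in> carrier G"
    using x subgroup.mem_carrier[OF A(1)] by blast
  have "a \<otimes> b \<in> C"
    using mult_of_private_elements[OF A(1) B(1) aA a(2) bB b(2)] cover by blast
  moreover have "b \<otimes> x \<notin> A" "b \<otimes> x \<in> B"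
    using b bB x xG mult_mem_subgroup_iff_right[OF A(1)] subgroup.m_closed[OF B(1)] by auto
  then have "a \<otimes> (b \<otimes> x) \<in> C"
    using mult_of_private_elements[OF A(1) B(1) aA a(2)] cover by blast
  then have "(a \<otimes> b) \<otimes> x \<in> C"
    using a b xG by (simp add: m_assoc)
  ultimately show "x \<in> C"
    using mult_mem_subgroup_iff_left[OF C(1)] xG by blast
qed

text \<open>
  Scorza's theorem, for abelian groups. Let \<open>D\<close> be the intersection. With \<open>a\<close> only in \<open>A\<close> and
  \<open>b\<close> only in \<open>B\<close>, the product \<open>a b\<close> is only in \<open>C\<close>. Any \<open>x\<close> in \<open>A - D\<close> behaves like
  \<open>a\<close>: also \<open>x b\<close> is in \<open>C\<close>, so \<open>x\<close> and \<open>a\<close> differ by an element of \<open>A \<inter> C = D\<close>. Hence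
  \<open>A - D\<close> is a single coset of \<open>D\<close>, and likewise \<open>B - D\<close> and \<open>C - D\<close>, so the quotient is
  \<open>{D, D a, D b, D a b}\<close>. Moreover \<open>a\<^sup>2\<close> is in \<open>A\<close>, and it cannot lie in
  \<open>D a\<close>, since then \<open>a\<close> would be in \<open>D\<close>; so it lies in \<open>D\<close>. The same holds for \<open>b\<close>.
\<close>
lemma (in comm_group) quotient_by_cover_intersection_klein_four:
  assumes A: "subgroup A G" "A \<noteq> carrier G"
    and B: "subgroup B G" "B \<noteq> carrier G"
    and C: "subgroup C G" "C \<noteq> carrier G"
    and cover: "carrier G = A \<union> B \<union> C"
  shows "G Mod (A \<inter> B \<inter> C) \<cong> integer_mod_group 2 \<times>\<times> integer_mod_group 2"
proof -
  define D where "D = A \<inter> B \<inter> C"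
  have AB: "A \<inter> B = D" and AC: "A \<inter> C = D" and BC: "B \<inter> C = D"
    using pairwise_Int_subset_third_of_cover[OF A B C] pairwise_Int_subset_third_of_cover[OF A C B]
      pairwise_Int_subset_third_of_cover[OF B C A] cover by (auto simp: D_def)
  have D: "subgroup D G"
    unfolding D_def using A B C by (intro subgroups_Inter_pair)
  interpret D: normal D G
    using D by (rule subgroup_imp_normal)
  interpret Q: comm_group "G Mod D"
    using D by (rule abelian_FactGroup)
  obtain a where a: "a \<in> carrier G" "a \<notin> B" "a \<notin> C"
    using two_proper_subgroups_not_cover[OF B C] by blast
  obtain b where b: "b \<in> carrier G" "b \<notin> A" "b \<notin> C"
    using two_proper_subgroups_not_cover[OF A C] by blast
  have aA: "a \<in> A" and bB: "b \<in> B"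
    using a b cover by auto
  have ab: "a \<otimes> b \<in> C" "a \<otimes> b \<notin> A" "a \<otimes> b \<notin> B"
    using mult_of_private_elements[OF A(1) B(1) aA a(2) bB b(2)] cover by blast+
  \<comment> \<open>Common principle behind the three coset computations: \<open>x\<close> and \<open>y\<close> in one member \<open>S\<close> of
     the cover are congruent modulo \<open>D\<close> if the same translation \<open>z\<close> moves both into another
     member \<open>T\<close>.\<close>
  have coset: "D #> x = D #> y"
    if "subgroup S G" "subgroup T G" "S \<inter> T = D"
      "x \<in> S" "y \<in> S" "z \<in> carrier G" "x \<otimes> z \<in> T" "y \<otimes> z \<in> T" for S T x y z
  proof -
    have xy: "x \<in> carrier G" "y \<in> carrier G"
      using that(4,5) subgroup.mem_carrier[OF that(1)] by blast+
    have "x \<otimes> inv y \<in> S"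
      using that by (simp add: subgroup.m_closed subgroup.m_inv_closed)
    moreover have "x \<otimes> inv y = (x \<otimes> z) \<otimes> inv (y \<otimes> z)"
      using that(6) xy by (simp add: inv_mult_group m_assoc) (simp add: flip: m_assoc)
    then have "x \<otimes> inv y \<in> T"
      using that by (simp add: subgroup.m_closed subgroup.m_inv_closed)
    ultimately have "x \<otimes> inv y \<in> D"
      using that by blast
    then have "x \<in> D #> y"
      using xy D.rcos_module is_group by blast
    then show ?thesis
      using repr_independence xy D by metis
  qed
  have A_coset: "D #> x = D #> a" if "x \<in> A" "x \<notin> D" for x
  proof -
    have x: "x \<in> carrier G" "x \<notin> B" using that AB subgroup.mem_carrier[OF A(1)] by blast+
    then have "x \<otimes> b \<in> C"
      using mult_of_private_elements[OF A(1) B(1) that(1) _ bB b(2)] cover by blast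
    then show ?thesis
      using coset[OF A(1) C(1) AC that(1) aA b(1) _ ab(1)] by blast
  qed
  have B_coset: "D #> x = D #> b" if "x \<in> B" "x \<notin> D" for x
  proof -
    have x: "x \<in> carrier G" "x \<notin> A" using that AB subgroup.mem_carrier[OF B(1)] by blast+
    then have "x \<otimes> a \<in> C"
      using mult_of_private_elements[OF B(1) A(1) that(1) _ aA a(2)] cover by blast
    then show ?thesis
      using coset[OF B(1) C(1) BC that(1) bB a(1) _] ab(1) a b m_comm by metis
  qed
  have C_coset: "D #> x = D #> (a \<otimes> b)" if "x \<in> C" "x \<notin> D" for x
  proof -
    have x: "x \<in> carrier G" "x \<notin> B" "x \<notin> A" using that BC AC subgroup.mem_carrier[OF C(1)] by blast+
    \<comment> \<open>Translating by the inverse of \<open>b\<close> brings both \<open>x\<close> and \<open>a b\<close> into \<open>A\<close>.\<close>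
    have "inv b \<in> B" "inv b \<notin> C"
      using b(1,3) subgroup.m_inv_closed[OF B(1) bB] subgroup.m_inv_closed[OF C(1), of "inv b"]
      by auto
    then have "x \<otimes> inv b \<in> A"
      using mult_of_private_elements[OF C(1) B(1) that(1) x(2)] cover by blast
    moreover have "a \<otimes> b \<otimes> inv b \<in> A"
      using a aA b by (simp add: m_assoc)
    ultimately show ?thesis
      using coset[OF C(1) A(1) _ that(1) ab(1), of "inv b"] AC b by blast
  qed
  have sq: "x \<otimes> x \<in> D" if "S = A \<or> S = B" "x \<in> S" "x \<notin> D" for S x
  proof (rule ccontr)
    assume nD: "x \<otimes> x \<notin> D"
    have S: "subgroup S G" using that A B by blast
    then have x: "x \<in> carrier G" "x \<otimes> x \<in> S"
      using that subgroup.mem_carrier[OF S] subgroup.m_closed[OF S] by blast+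
    then have "D #> (x \<otimes> x) = D #> x"
      using that nD A_coset B_coset by metis
    then have "x \<otimes> x \<otimes> inv x \<in> D"
      using x D.rcos_module[OF is_group] rcos_self[OF _ D] by (metis m_closed)
    then show False
      using x that by (simp add: m_assoc)
  qed
  have nD: "a \<notin> D" "b \<notin> D"
    using a b by (auto simp: D_def)
  have "G Mod D \<cong> integer_mod_group 2 \<times>\<times> integer_mod_group 2"
  proof (rule Q.klein_four_groupI[of "D #> a" "D #> b"])
    show "D #> a \<in> carrier (G Mod D)" "D #> b \<in> carrier (G Mod D)"
      using a b by (auto simp: carrier_FactGroup)
    show "D #> a \<noteq> \<one>\<^bsub>G Mod D\<^esub>" "D #> b \<noteq> \<one>\<^bsub>G Mod D\<^esub>"
      using a b nD coset_join1 D by (auto simp: D.subset)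
    show "(D #> a) \<otimes>\<^bsub>G Mod D\<^esub> (D #> a) = \<one>\<^bsub>G Mod D\<^esub>"
         "(D #> b) \<otimes>\<^bsub>G Mod D\<^esub> (D #> b) = \<one>\<^bsub>G Mod D\<^esub>"
      using a b sq[OF _ aA nD(1)] sq[OF _ bB nD(2)] by (simp_all add: D.rcos_sum coset_join2 D)
    show "D #> a \<noteq> D #> b"
    proof
      assume "D #> a = D #> b"
      then have "a \<in> D #> b" using rcos_self[OF a(1) D] by simp
      then obtain d where "d \<in> D" "a = d \<otimes> b" by (auto simp: r_coset_def)
      then show False using a bB subgroup.m_closed[OF B(1)] by (auto simp: D_def)
    qed
    have "D #> x \<in> {D, D #> a, D #> b, D #> (a \<otimes> b)}" if "x \<in> carrier G" for x
      using that cover A_coset[of x] B_coset[of x] C_coset[of x] coset_join2[OF that D] by blast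
    then show "carrier (G Mod D) \<subseteq> {\<one>\<^bsub>G Mod D\<^esub>, D #> a, D #> b, (D #> a) \<otimes>\<^bsub>G Mod D\<^esub> (D #> b)}"
      using a b by (auto simp: carrier_FactGroup D.rcos_sum)
  qed
  then show ?thesis
    by (simp add: D_def)
qed

section \<open>Subgroups above a subgroup of index four\<close>

text \<open>
  A proper subgroup \<open>H\<close> has index at least two, hence at most \<open>2 |N|\<close> elements, and the disjoint
  cosets \<open>N\<close> and \<open>N x\<close> already supply that many.
\<close>
lemma (in group) intermediate_subgroup_of_index_four:
  assumes fin: "finite (carrier G)"
    and N: "subgroup N G" and idx: "card (rcosets N) = 4"
    and H: "subgroup H G" "H \<noteq> carrier G" and NH: "N \<subseteq> H" and x: "x \<in> H" "x \<notin> N"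
  shows "H = N \<union> (N #> x)"
proof -
  have xG: "x \<in> carrier G"
    using x subgroup.mem_carrier[OF H(1)] by blast
  have finH: "finite H"
    using subgroup.subset[OF H(1)] fin by (rule finite_subset)
  have sub: "N \<union> (N #> x) \<subseteq> H"
    using NH x subgroup.m_closed[OF H(1)] by (auto simp: r_coset_def)
  have "N \<inter> (N #> x) = {}"
    using rcos_disjoint[OF N] subgroup.subgroup_in_rcosets[OF N is_group] rcosetsI[OF _ xG]
      subgroup.subset[OF N] x(2) rcos_self[OF xG N]
    by (metis (no_types, lifting) disjnt_def pairwise_def)
  moreover have "card (N #> x) = card N"
    using card_rcosets_equal[OF rcosetsI[OF _ xG]] subgroup.subset[OF N] by simp
  ultimately have card_union: "card (N \<union> (N #> x)) = 2 * card N"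
    using sub finH by (subst card_Un_disjoint) (auto intro: finite_subset)
  have "H \<subset> carrier G"
    using H(2) subgroup.subset[OF H(1)] by blast
  then have "card H < order G"
    unfolding order_def using fin by (rule psubset_card_mono[rotated])
  then have "card (rcosets H) * card H > 1 * card H"
    using lagrange[OF H(1)] by simp
  then have "card (rcosets H) \<ge> 2"
    unfolding mult_less_cancel2 by linarith
  then have "2 * card H \<le> order G"
    using lagrange[OF H(1)] by (metis mult_le_mono1)
  then have "card H \<le> card (N \<union> (N #> x))"
    using lagrange[OF N] idx card_union by simp
  then show ?thesis
    using sub finH card_seteq by blast
qed

section \<open>Centralizers and the center\<close>

context nonunital_ring
begin

lemma centralizer_subgroup:
  assumes r: "r \<in> carrier R"
  shows "subgroup (centralizer R r) (add_monoid R)"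
proof
  have r0: "r \<otimes> \<zero> = \<zero>" and l0: "\<zero> \<otimes> r = \<zero>"
    using mult_r_distr[of \<zero> \<zero> r] mult_l_distr[of \<zero> \<zero> r] r mult_closed[of r \<zero>] mult_closed[of \<zero> r]
    by (metis add.r_cancel_one' r_zero zero_closed)+
  then show "\<one>\<^bsub>add_monoid R\<^esub> \<in> centralizer R r"
    by (simp add: centralizer_def)
  fix s assume "s \<in> centralizer R r"
  then have s: "s \<in> carrier R" "r \<otimes> s = s \<otimes> r"
    by (auto simp: centralizer_def)
  have "r \<otimes> (\<ominus> s) \<oplus> r \<otimes> s = \<zero>"
    using mult_r_distr[of "\<ominus> s" s r] r s r0 by (simp add: l_neg)
  moreover have "(\<ominus> s) \<otimes> r \<oplus> r \<otimes> s = \<zero>"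
    using mult_l_distr[of "\<ominus> s" s r] r s l0 by (simp add: l_neg)
  ultimately have "r \<otimes> (\<ominus> s) = (\<ominus> s) \<otimes> r"
    using r s mult_closed by (metis a_inv_closed add.r_cancel)
  then show "inv\<^bsub>add_monoid R\<^esub> s \<in> centralizer R r"
    using s by (simp add: centralizer_def flip: a_inv_def)
qed (auto simp: centralizer_def r mult_r_distr mult_l_distr)

lemma mem_own_centralizer: "r \<in> carrier R \<Longrightarrow> r \<in> centralizer R r"
  by (simp add: centralizer_def)

lemma center_subset_centralizer: "r \<in> carrier R \<Longrightarrow> center R \<subseteq> centralizer R r"
  by (auto simp: center_def centralizer_def)

lemma centralizer_eq_carrier_iff:
  "r \<in> carrier R \<Longrightarrow> centralizer R r = carrier R \<longleftrightarrow> r \<in> center R"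
  by (force simp: center_def centralizer_def)

lemma center_eq_Inter_Cent: "center R = \<Inter>(Cent R)"
  by (auto simp: center_def centralizer_def Cent_def)

lemma center_subgroup: "subgroup (center R) (add_monoid R)"
  unfolding center_eq_Inter_Cent
  by (rule add.subgroups_Inter) (auto simp: Cent_def centralizer_subgroup)

lemma carrier_mem_Cent: "carrier R \<in> Cent R"
proof -
  have "\<zero> \<in> center R"
    using subgroup.one_closed[OF center_subgroup] by simp
  then show ?thesis
    unfolding Cent_def using centralizer_eq_carrier_iff[of \<zero>] by (metis imageI zero_closed)
qed

section \<open>Four centralizers\<close>

lemma quotient_klein_four_if_card_Cent:
  assumes "card (Cent R) = 4"
  shows "R A_Mod (center R) \<cong> integer_mod_group 2 \<times>\<times> integer_mod_group 2"
proof -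
  have "card (Cent R - {carrier R}) = 3"
    using assms carrier_mem_Cent by simp
  then obtain A B C where ABC: "Cent R - {carrier R} = {A, B, C}"
    unfolding card_3_iff by (elim exE conjE) (rule that)
  have Cent: "Cent R = {carrier R, A, B, C}"
    using ABC carrier_mem_Cent by blast
  have sub: "subgroup S (add_monoid R)" if "S \<in> Cent R" for S
    using that centralizer_subgroup by (auto simp: Cent_def)
  have proper: "S \<noteq> carrier R" if "S \<in> {A, B, C}" for S
    using that ABC by blast
  have subset: "A \<subseteq> carrier R" "B \<subseteq> carrier R" "C \<subseteq> carrier R"
    using Cent by (auto simp: Cent_def centralizer_def)
  have center: "center R = A \<inter> B \<inter> C"
    unfolding center_eq_Inter_Cent Cent using subset by auto
  have "carrier R \<subseteq> A \<union> B \<union> C"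
  proof
    fix r assume r: "r \<in> carrier R"
    show "r \<in> A \<union> B \<union> C"
    proof (cases "r \<in> center R")
      case True
      then show ?thesis using r center by blast
    next
      case False
      then have "centralizer R r \<in> {A, B, C}"
        using r centralizer_eq_carrier_iff ABC by (auto simp: Cent_def)
      then show ?thesis using mem_own_centralizer[OF r] by blast
    qed
  qed
  then have "carrier R = A \<union> B \<union> C"
    using subset by blast
  then show ?thesis
    unfolding A_FactGroup_def center
    using sub proper Cent
    by (intro comm_group.quotient_by_cover_intersection_klein_four a_comm_group) simp_all
qed

text \<open>
  The map \<open>S \<mapsto> Z \<union> S\<close> is a bijection from the three nontrivial cosets of the center to the
  proper centralizers. It is injective because distinct cosets are disjoint, so that \<open>S\<close> is
  recovered by removing \<open>Z\<close>.
\<close>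
lemma card_Cent_if_card_quotient:
  assumes fin: "finite (carrier R)"
    and idx: "card (a_rcosets (center R)) = 4"
  shows "card (Cent R) = 4"
proof -
  let ?Z = "center R"
  let ?Q = "a_rcosets ?Z"
  have cent: "centralizer R r = ?Z \<union> (?Z +> r)" if "r \<in> carrier R" "r \<notin> ?Z" for r
    using add.intermediate_subgroup_of_index_four[OF _ center_subgroup _ centralizer_subgroup[OF that(1)]]
      that fin idx centralizer_eq_carrier_iff center_subset_centralizer mem_own_centralizer
    by (simp add: A_RCOSETS_def a_r_coset_def)
  have coset_eq: "?Z +> r = ?Z \<longleftrightarrow> r \<in> ?Z" if "r \<in> carrier R" for r
    using that a_coset_join1 a_coset_join2 center_subgroup by blast
  have Q: "?Q = (+>) ?Z ` carrier R"
    by (auto simp: A_RCOSETS_def')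
  have Z: "?Z \<in> ?Q"
    using coset_eq[of \<zero>] subgroup.one_closed[OF center_subgroup] by (force simp: Q)
  have "(\<union>) ?Z ` (?Q - {?Z}) = Cent R - {carrier R}"
  proof (intro equalityI subsetI)
    fix S assume "S \<in> (\<union>) ?Z ` (?Q - {?Z})"
    then obtain r where r: "r \<in> carrier R" "r \<notin> ?Z" "S = ?Z \<union> (?Z +> r)"
      using coset_eq by (auto simp: Q)
    then have "S = centralizer R r" using cent by simp
    then show "S \<in> Cent R - {carrier R}"
      using r centralizer_eq_carrier_iff by (auto simp: Cent_def)
  next
    fix S assume "S \<in> Cent R - {carrier R}"
    then obtain r where r: "r \<in> carrier R" "S = centralizer R r" "r \<notin> ?Z"
      using centralizer_eq_carrier_iff by (auto simp: Cent_def)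
    then show "S \<in> (\<union>) ?Z ` (?Q - {?Z})"
      using cent coset_eq by (auto simp: Q)
  qed
  moreover have "inj_on ((\<union>) ?Z) (?Q - {?Z})"
  proof -
    have disj: "S \<inter> ?Z = {}" if "S \<in> ?Q - {?Z}" for S
      using that Z add.rcos_disjoint[OF center_subgroup]
      by (auto simp: A_RCOSETS_def pairwise_def disjnt_def)
    show ?thesis
    proof (rule inj_onI)
      fix S T assume "S \<in> ?Q - {?Z}" "T \<in> ?Q - {?Z}" "?Z \<union> S = ?Z \<union> T"
      then show "S = T" using disj[of S] disj[of T] by blast
    qed
  qed
  ultimately have "card (Cent R - {carrier R}) = card (?Q - {?Z})"
    using card_image by metis
  then show ?thesis
    using Z idx carrier_mem_Cent fin by (simp add: Cent_def card_Diff_singleton)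
qed

end

theorem theorem3p2:
  fixes R :: "('a, 'm) ring_scheme"
  assumes "nonunital_ring R"
    and "finite (carrier R)"
    and "\<not> commutative R"
  shows "card (Cent R) = 4 \<longleftrightarrow>
         R A_Mod (center R) \<cong> integer_mod_group 2 \<times>\<times> integer_mod_group 2"
proof
  assume "card (Cent R) = 4"
  then show "R A_Mod (center R) \<cong> integer_mod_group 2 \<times>\<times> integer_mod_group 2"
    by (rule nonunital_ring.quotient_klein_four_if_card_Cent[OF assms(1)])
next
  assume "R A_Mod (center R) \<cong> integer_mod_group 2 \<times>\<times> integer_mod_group 2"
  from iso_same_card[OF this] have "card (a_rcosets\<^bsub>R\<^esub> (center R)) = 4"
    by (simp add: DirProd_def carrier_integer_mod_group card_cartesian_product
        A_FactGroup_def FactGroup_def A_RCOSETS_def)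
  then show "card (Cent R) = 4"
    by (rule nonunital_ring.card_Cent_if_card_quotient[OF assms(1) assms(2)])
qed

end
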